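(* Let $\mathbb{K}$ be an algebraically closed field of characteristic zero and let $$R = \frac{\mathbb{K} \langle x_1, x_2, x_3, x_4 \rangle}{\langle x_1^2-x_4^2,\ x_2^2-x_3^2,\ x_4x_1-x_2x_3,\ x_1x_4-x_3x_2,\ x_1x_3-x_2x_4,\ x_3x_1-x_4x_2 \rangle}.$$ Grade $R$ by the modular group $M_{16}$ of order 16 by assigning $x_1,x_2,x_3,x_4$ the group degrees $a, acd, ab, abc$ respectively. Then the identity component (invariant subalgebra) $R_e$ is the subalgebra of $R$ generated by the set $Y=\{x_1x_2,\ x_2x_1,\ x_3x_4,\ x_4x_3\}$, and $R_e$ is isomorphic to $\mathbb{K}[z_1,z_2,z_3,z_4]$, the commutative polynomial ring in four variables.
   Context: $M_{16}=\langle a,b,c,d \mid a^2=c,\ b^2=d^2=e,\ c^2=d,\ a^{-1}ba=bd,\ c,d \text{ central}\rangle$, a group of order 16 with identity $e$. The defining relations of $R$ are homogeneous for the stated $M_{16}$-degrees, so $R=\bigoplus_{g\in M_{16}}R_g$ is $M_{16}$-graded, and $R_e$ denotes the component of group degree $e$; equivalently, $R_e$ is the fixed subring of $R$ under the corresponding action of the Hopf algebra $\mathbb{K}^{M_{16}}=\operatorname{Hom}_{\mathbb{K}}(\mathbb{K}M_{16},\mathbb{K})$. *)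

theory Defs
  imports "HOL-Algebra.Algebraic_Closure_Type" "HOL-Library.Poly_Mapping" "HOL-Library.Numeral_Type"
begin

text \<open>
  A \<open>\<K>\<close>-algebra is a (not necessarily commutative) ring \<open>A\<close> together with its structure map
  \<open>\<iota> : \<K> \<rightarrow> A, k \<mapsto> k \<cdot> 1\<close>. A subalgebra is a unital subring closed under scalars, i.e. containing
  the range of \<open>\<iota>\<close>; a \<open>\<K>\<close>-algebra homomorphism is a ring homomorphism commuting with the
  structure maps. (The locale \<open>subalgebra\<close> of \<open>HOL-Algebra\<close> only describes submodules.)
\<close>

definition alg_subalgebra :: "'a ring \<Rightarrow> ('k \<Rightarrow> 'a) \<Rightarrow> 'a set \<Rightarrow> bool" where
  "alg_subalgebra A \<iota> S \<longleftrightarrow> subring S A \<and> range \<iota> \<subseteq> S"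

definition alg_generated :: "'a ring \<Rightarrow> ('k \<Rightarrow> 'a) \<Rightarrow> 'a set \<Rightarrow> 'a set" where
  "alg_generated A \<iota> Y = \<Inter>{S. alg_subalgebra A \<iota> S \<and> Y \<subseteq> S}"

definition alg_isomorphic ::
    "'a ring \<Rightarrow> ('k \<Rightarrow> 'a) \<Rightarrow> 'b ring \<Rightarrow> ('k \<Rightarrow> 'b) \<Rightarrow> bool" where
  "alg_isomorphic A \<iota> B \<kappa> \<longleftrightarrow> (\<exists>h \<in> ring_iso A B. \<forall>k. h (\<iota> k) = \<kappa> k)"

text \<open>The letters \<open>(x, True)\<close> and \<open>(x, False)\<close> stand for \<open>x\<close> and its formal inverse.\<close>

type_synonym 'x gword = "('x \<times> bool) list"

inductive_set pres_rel :: "('x gword \<times> 'x gword) set \<Rightarrow> ('x gword \<times> 'x gword) set"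
  for S :: "('x gword \<times> 'x gword) set" where
  rel: "(u, v) \<in> S \<Longrightarrow> (u, v) \<in> pres_rel S"
| cancel: "([(x, s), (x, \<not> s)], []) \<in> pres_rel S"
| refl: "(u, u) \<in> pres_rel S"
| sym: "(u, v) \<in> pres_rel S \<Longrightarrow> (v, u) \<in> pres_rel S"
| trans: "(u, v) \<in> pres_rel S \<Longrightarrow> (v, w) \<in> pres_rel S \<Longrightarrow> (u, w) \<in> pres_rel S"
| cong: "(u, v) \<in> pres_rel S \<Longrightarrow> (p @ u @ q, p @ v @ q) \<in> pres_rel S"

definition presented_group :: "('x gword \<times> 'x gword) set \<Rightarrow> 'x gword set monoid" where
  "presented_group S =
     \<lparr>carrier = UNIV // pres_rel S,
      monoid.mult = (\<lambda>A B. \<Union>u\<in>A. \<Union>v\<in>B. pres_rel S `` {u @ v}),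
      one = pres_rel S `` {[]}\<rparr>"

datatype m16_gen = Ga | Gb | Gc | Gd

definition m16_relations :: "(m16_gen gword \<times> m16_gen gword) set" where
  "m16_relations =
     (let a = (Ga, True); a' = (Ga, False); b = (Gb, True); c = (Gc, True); d = (Gd, True)
      in {([a, a], [c]), ([b, b], []), ([d, d], []), ([c, c], [d]), ([a', b, a], [b, d])}
         \<union> {([z, (g, True)], [(g, True), z]) | z g. z \<in> {c, d}})"

definition M16 :: "m16_gen gword set monoid" where
  "M16 = presented_group m16_relations"

definition m16 :: "m16_gen \<Rightarrow> m16_gen gword set" where
  "m16 g = pres_rel m16_relations `` {[(g, True)]}"

text \<open>
  The free monoid, written additively so that \<open>'v word \<Rightarrow>\<^sub>0 'k\<close> (finitely supported functions under
  convolution) is the free associative algebra over \<open>'k\<close> on \<open>'v\<close>.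
\<close>

datatype 'v word = Word (letters: "'v list")

instantiation word :: (type) monoid_add
begin

definition zero_word :: "'a word" where
  "zero_word = Word []"

definition plus_word :: "'a word \<Rightarrow> 'a word \<Rightarrow> 'a word" where
  "plus_word u v = Word (letters u @ letters v)"

instance
  by standard (simp_all add: zero_word_def plus_word_def)

end

datatype xvar = X1 | X2 | X3 | X4

type_synonym 'k free_alg = "xvar word \<Rightarrow>\<^sub>0 'k"

definition free_var :: "xvar \<Rightarrow> 'k::field free_alg" where
  "free_var v = Poly_Mapping.single (Word [v]) 1"

definition R_relators :: "'k::field free_alg set" where
  "R_relators =
     (let x\<^sub>1 = free_var X1; x\<^sub>2 = free_var X2; x\<^sub>3 = free_var X3; x\<^sub>4 = free_var X4
      in {x\<^sub>1 ^ 2 - x\<^sub>4 ^ 2, x\<^sub>2 ^ 2 - x\<^sub>3 ^ 2, x\<^sub>4 * x\<^sub>1 - x\<^sub>2 * x\<^sub>3,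
          x\<^sub>1 * x\<^sub>4 - x\<^sub>3 * x\<^sub>2, x\<^sub>1 * x\<^sub>3 - x\<^sub>2 * x\<^sub>4, x\<^sub>3 * x\<^sub>1 - x\<^sub>4 * x\<^sub>2})"

definition R_ideal :: "'k::field free_alg set" where
  "R_ideal = Idl\<^bsub>ring_of_type_algebra\<^esub> R_relators"

definition R_alg :: "'k::field free_alg set ring" where
  "R_alg = ring_of_type_algebra Quot R_ideal"

definition R_class :: "'k::field free_alg \<Rightarrow> 'k free_alg set" where
  "R_class p = R_ideal +>\<^bsub>ring_of_type_algebra\<^esub> p"

definition R_const :: "'k::field \<Rightarrow> 'k free_alg set" where
  "R_const k = R_class (Poly_Mapping.single 0 k)"

definition R_var :: "xvar \<Rightarrow> 'k::field free_alg set" where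
  "R_var v = R_class (free_var v)"

fun var_degree :: "xvar \<Rightarrow> m16_gen gword set" where
  "var_degree X1 = m16 Ga"
| "var_degree X2 = m16 Ga \<otimes>\<^bsub>M16\<^esub> m16 Gc \<otimes>\<^bsub>M16\<^esub> m16 Gd"
| "var_degree X3 = m16 Ga \<otimes>\<^bsub>M16\<^esub> m16 Gb"
| "var_degree X4 = m16 Ga \<otimes>\<^bsub>M16\<^esub> m16 Gb \<otimes>\<^bsub>M16\<^esub> m16 Gc"

definition word_degree :: "xvar word \<Rightarrow> m16_gen gword set" where
  "word_degree w = foldr (\<lambda>v g. var_degree v \<otimes>\<^bsub>M16\<^esub> g) (letters w) \<one>\<^bsub>M16\<^esub>"

text \<open>
  As the relators are homogeneous, the grading of the free algebra descends to \<open>R\<close>: the component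
  of degree \<open>g\<close> consists of the classes of linear combinations of words of degree \<open>g\<close>.
\<close>

definition R_component :: "m16_gen gword set \<Rightarrow> 'k::field free_alg set set" where
  "R_component g = R_class ` {p. \<forall>w \<in> Poly_Mapping.keys p. word_degree w = g}"

text \<open>Exponent vectors are indexed by the four-element numeral type \<open>4\<close>.\<close>

type_synonym 'k poly4 = "(4 \<Rightarrow>\<^sub>0 nat) \<Rightarrow>\<^sub>0 'k"

definition poly4_ring :: "'k::field poly4 ring" where
  "poly4_ring = ring_of_type_algebra"

definition poly4_const :: "'k::field \<Rightarrow> 'k poly4" where
  "poly4_const k = Poly_Mapping.single 0 k"

end

theory Submission
  imports Defs
begin

text \<open>
  The six relations are those of a set-theoretic solution of the Yang--Baxter equation, so \<open>R\<close> is the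
  monoid algebra of a monoid of I-type: words modulo the relations are classified by a bijective
  1-cocycle with values in \<open>\<nat>\<^sup>4\<close>, each letter rotating the coordinates by one step. The cocycle modulo
  \<open>2\<close>, together with the total rotation, factors through the \<open>M\<^sub>1\<^sub>6\<close>-degree, so a word of degree \<open>e\<close>
  has an even cocycle and trivial rotation. The elements of \<open>Y\<close> have cocycles \<open>2 e\<^sub>i\<close> and trivial
  rotation. Hence halving the cocycle identifies the monoid of classes of words of degree \<open>e\<close> with
  \<open>\<nat>\<^sup>4\<close>, generated by \<open>Y\<close>.
\<close>

section \<open>Words modulo the quadratic relations\<close>

lemma forall_numeral_4: "(\<forall>i::4. P i) \<longleftrightarrow> P 0 \<and> P 1 \<and> P 2 \<and> P 3"
proof -
  have "x = 0 \<or> x = 1 \<or> x = 2 \<or> x = 3" for x :: 4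
  proof (induct x)
    case (of_int z)
    then have "z = 0 \<or> z = 1 \<or> z = 2 \<or> z = 3" by auto
    then show ?case by auto
  qed
  then show ?thesis by metis
qed

section \<open>Letters as rotations, and the 1-cocycle on words\<close>

fun var_index :: "xvar \<Rightarrow> 4" where
  "var_index X1 = 1"
| "var_index X2 = 2"
| "var_index X3 = 3"
| "var_index X4 = 0"

fun var_turn :: "xvar \<Rightarrow> 4" where
  "var_turn X1 = - 1"
| "var_turn X2 = 1"
| "var_turn X3 = - 1"
| "var_turn X4 = 1"

definition turns :: "xvar list \<Rightarrow> 4" where
  "turns w = sum_list (map var_turn w)"

text \<open>
  With the letter of index \<open>i\<close> written \<open>x\<^sub>i\<close> (indices modulo \<open>4\<close>, so \<open>X4\<close> has index \<open>0\<close>), a letter acts on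
  \<open>\<nat>\<^sup>4\<close> by rotating the coordinates by its turn; \<open>cocycle\<close> is the 1-cocycle with
  \<open>x\<^sub>i \<mapsto> e\<^sub>i\<close>.
\<close>

fun cocycle :: "xvar list \<Rightarrow> 4 \<Rightarrow> nat" where
  "cocycle [] j = 0"
| "cocycle (v # w) j = of_bool (j = var_index v) + cocycle w (j - var_turn v)"

lemma turns_simps [simp]:
  "turns [] = 0" "turns (v # w) = var_turn v + turns w" "turns (u @ w) = turns u + turns w"
  by (simp_all add: turns_def)

lemma cocycle_append: "cocycle (u @ w) j = cocycle u j + cocycle w (j - turns u)"
  by (induction u arbitrary: j) (simp_all add: algebra_simps)

lemma sum_of_bool_singleton: "(\<Sum>j\<in>UNIV. of_bool (j = (i::'a::finite)) :: nat) = 1"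
  by (simp add: of_bool_def)

text \<open>Each letter contributes one unit, and rotating coordinates keeps their sum. Hence words
  with equal cocycles have equal length.\<close>

lemma sum_cocycle: "(\<Sum>j\<in>UNIV. cocycle w j) = length w"
proof (induction w)
  case (Cons v w)
  have "(\<Sum>j\<in>UNIV. cocycle w (j - var_turn v)) = (\<Sum>j\<in>UNIV. cocycle w j)"
    by (rule sum.reindex_bij_witness[of _ "\<lambda>j. j + var_turn v" "\<lambda>j. j - var_turn v"]) auto
  with Cons show ?case by (simp add: sum.distrib sum_of_bool_singleton)
qed simp

lemma var_index_surj: "\<exists>v. var_index v = i"
proof -
  have "\<forall>i. \<exists>v. var_index v = i"
    unfolding forall_numeral_4
    by (metis var_index.simps)
  then show ?thesis by blast
qed

text \<open>Induction on the total of \<open>f\<close>: a positive coordinate supplies the first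
  letter, and the remaining vector, rotated back by that letter's turn, is the cocycle of the
  tail.\<close>

lemma cocycle_surj: "\<exists>w. cocycle w = f"
proof (induction "\<Sum>j\<in>UNIV. f j" arbitrary: f)
  case 0
  then have "cocycle [] = f" by auto
  then show ?case by blast
next
  case (Suc n)
  then obtain i where i: "f i > 0"
    by (metis (full_types) finite sum.neutral gr0I nat.distinct(1))
  obtain v where v: "var_index v = i" using var_index_surj by blast
  let ?g = "\<lambda>j. f j - of_bool (j = i)"
  have f: "f j = of_bool (j = i) + ?g j" for j using i by auto
  have "(\<Sum>j\<in>UNIV. f j) = 1 + (\<Sum>j\<in>UNIV. ?g j)"
    by (subst f) (simp only: sum.distrib sum_of_bool_singleton)
  moreover have "(\<Sum>j\<in>UNIV. ?g (j + var_turn v)) = (\<Sum>j\<in>UNIV. ?g j)"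
    by (rule sum.reindex_bij_witness[of _ "\<lambda>j. j - var_turn v" "\<lambda>j. j + var_turn v"]) auto
  ultimately have "n = (\<Sum>j\<in>UNIV. ?g (j + var_turn v))"
    using Suc.hyps(2) by simp
  from Suc.hyps(1)[OF this] obtain w where w: "cocycle w = (\<lambda>j. ?g (j + var_turn v))" by blast
  have "cocycle (v # w) = f" using f v by (auto simp: w fun_eq_iff)
  then show ?case by blast
qed

section \<open>Classification of words modulo the relations by their cocycles\<close>

definition quadratic_relations :: "(xvar list \<times> xvar list) set" where
  "quadratic_relations =
     {([X1, X1], [X4, X4]), ([X2, X2], [X3, X3]), ([X4, X1], [X2, X3]),
      ([X1, X4], [X3, X2]), ([X1, X3], [X2, X4]), ([X3, X1], [X4, X2])}"

inductive word_eq :: "xvar list \<Rightarrow> xvar list \<Rightarrow> bool" where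
  rel: "(u, v) \<in> quadratic_relations \<Longrightarrow> word_eq u v"
| refl: "word_eq u u"
| sym: "word_eq u v \<Longrightarrow> word_eq v u"
| trans: "word_eq u v \<Longrightarrow> word_eq v w \<Longrightarrow> word_eq u w"
| cong: "word_eq u v \<Longrightarrow> word_eq (p @ u @ q) (p @ v @ q)"

lemma quadratic_relations_invariant:
  assumes "(u, v) \<in> quadratic_relations"
  shows "cocycle u = cocycle v" "turns u = turns v"
proof -
  have "\<forall>j. cocycle u j = cocycle v j"
    using assms unfolding forall_numeral_4 quadratic_relations_def by auto
  then show "cocycle u = cocycle v" by blast
  show "turns u = turns v" using assms by (auto simp: quadratic_relations_def)
qed

text \<open>The first letters of the two sides of the six relations run through the six pairs of
  distinct letters, each once, so any two distinct letters have a common right multiple of length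
  two. By the equations on \<open>k\<close> and \<open>l\<close>, both words have one unit at the
  index of \<open>i\<close> and one at that of \<open>j\<close>, and their turns agree.\<close>

lemma exchange:
  assumes "i \<noteq> j"
  obtains k l where "word_eq [i, k] [j, l]"
    "var_index k = var_index j - var_turn i" "var_index l = var_index i - var_turn j"
    "var_turn i + var_turn k = var_turn j + var_turn l"
proof -
  \<comment> \<open>Quantifiers over letters become disjunctions, which leaves a finite
    check.\<close>
  have ex: "(\<exists>x. P x) \<longleftrightarrow> P X1 \<or> P X2 \<or> P X3 \<or> P X4" for P
    by (metis xvar.exhaust)
  have "\<exists>k l. (([i, k], [j, l]) \<in> quadratic_relations \<or> ([j, l], [i, k]) \<in> quadratic_relations) \<and>
    var_index k = var_index j - var_turn i \<and> var_index l = var_index i - var_turn j \<and>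
    var_turn i + var_turn k = var_turn j + var_turn l"
    using assms unfolding ex quadratic_relations_def by (cases i; cases j) simp_all
  then show ?thesis using that by (metis word_eq.rel word_eq.sym)
qed

lemma word_eq_Cons: "word_eq u v \<Longrightarrow> word_eq (x # u) (x # v)"
  using word_eq.cong[of u v "[x]" "[]"] by simp

lemma cocycle_Cons_cancel:
  assumes "cocycle (x # u) = cocycle (x # v)"
  shows "cocycle u = cocycle v"
proof
  fix j
  show "cocycle u j = cocycle v j" using fun_cong[OF assms, of "j + var_turn x"] by simp
qed

text \<open>Induction on the length. Equal first letters cancel. Distinct ones are reconciled
  through words \<open>x # k # t\<close> and \<open>y # l # t\<close> with the cocycle of
  \<open>u\<close> and \<open>v\<close>: these two are equivalent by \<open>exchange\<close>, and
  the induction hypothesis compares the tails.\<close>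

lemma word_eq_if_cocycle_eq: "cocycle u = cocycle v \<Longrightarrow> word_eq u v"
proof (induction "length u" arbitrary: u v rule: less_induct)
  case less
  have len: "length u = length v" using sum_cocycle[of u] sum_cocycle[of v] less.prems by simp
  show ?case
  proof (cases u)
    case Nil
    then show ?thesis using len by (simp add: word_eq.refl)
  next
    case u: (Cons x u')
    then obtain y v' where v: "v = y # v'" using len by (cases v) auto
    show ?thesis
    proof (cases "x = y")
      case True
      then have "cocycle u' = cocycle v'"
        using less.prems unfolding u v True by (rule_tac cocycle_Cons_cancel)
      then have "word_eq u' v'" using less.hyps u by simp
      then show ?thesis using True u v by (simp add: word_eq_Cons)
    next
      case False
      obtain k l where kl: "word_eq [x, k] [y, l]"
        "var_index k = var_index y - var_turn x" "var_index l = var_index x - var_turn y"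
        "var_turn x + var_turn k = var_turn y + var_turn l"
        using exchange[OF False] .
      have ne: "var_index x \<noteq> var_index y" using False by (cases x; cases y) simp_all
      \<comment> \<open>\<open>?s\<close> is the common turn of \<open>[x, k]\<close> and
        \<open>[y, l]\<close>; \<open>?r\<close> is what remains of the cocycle after removing the
        two units of these prefixes. The tail \<open>t\<close> realises \<open>?r\<close> rotated
        back by \<open>?s\<close>.\<close>
      let ?s = "var_turn x + var_turn k"
      let ?r = "\<lambda>j. cocycle u j - of_bool (j = var_index x) - of_bool (j = var_index y)"
      obtain t where t: "cocycle t = (\<lambda>j. ?r (j + ?s))"
        using cocycle_surj by blast
      \<comment> \<open>The first letters of \<open>u\<close> and \<open>v\<close> make two
        different coordinates positive, so the truncated subtractions in \<open>?r\<close> lose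
        nothing.\<close>
      have rest: "cocycle u j = of_bool (j = var_index x) + of_bool (j = var_index y) + ?r j" for j
      proof -
        have "cocycle u (var_index x) > 0" using u by simp
        moreover have "cocycle u (var_index y) > 0" unfolding less.prems using v by simp
        ultimately show ?thesis using ne by auto
      qed
      have "cocycle (x # k # t) = cocycle u"
      proof
        fix j
        have "cocycle (x # k # t) j =
            of_bool (j = var_index x) + of_bool (j = var_index y) + ?r j"
          by (simp only: cocycle.simps t kl(2)) (simp add: algebra_simps)
        then show "cocycle (x # k # t) j = cocycle u j" using rest[of j] by simp
      qed
      moreover have "cocycle (y # l # t) = cocycle u"
      proof
        fix j
        \<comment> \<open>Equality of the turns lets the same \<open>t\<close> follow both
          prefixes.\<close>
        have "j - var_turn y - var_turn l + ?s = j" unfolding kl(4) by simp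
        then have "cocycle (y # l # t) j =
            of_bool (j = var_index x) + of_bool (j = var_index y) + ?r j"
          by (simp only: cocycle.simps t kl(3)) (simp add: algebra_simps)
        then show "cocycle (y # l # t) j = cocycle u j" using rest[of j] by simp
      qed
      ultimately have "cocycle u' = cocycle (k # t)" "cocycle v' = cocycle (l # t)"
        unfolding less.prems using less.prems u v cocycle_Cons_cancel by metis+
      then have "word_eq u' (k # t)" "word_eq v' (l # t)"
        using less.hyps[of u'] less.hyps[of v'] u v len by simp_all
      then have "word_eq u (x # k # t)" "word_eq v (y # l # t)"
        using u v by (simp_all add: word_eq_Cons)
      moreover have "word_eq (x # k # t) (y # l # t)"
        using word_eq.cong[OF kl(1), of "[]" t] by simp
      ultimately show ?thesis by (meson word_eq.trans word_eq.sym)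
    qed
  qed
qed

text \<open>The words in \<open>Y\<close>: \<open>square_pair i\<close> has cocycle \<open>2 e\<^sub>i\<close>.\<close>

fun square_pair :: "4 \<Rightarrow> xvar list" where
  "square_pair i = (if i = 1 then [X1, X2] else if i = 2 then [X2, X1]
     else if i = 3 then [X3, X4] else [X4, X3])"

definition square_power :: "4 \<Rightarrow> nat \<Rightarrow> xvar list" where
  "square_power i n = concat (replicate n (square_pair i))"

text \<open>Normal form of the monomial with exponent vector \<open>f\<close>: a product of elements
  of \<open>Y\<close> in a fixed order.\<close>

definition square_word :: "(4 \<Rightarrow>\<^sub>0 nat) \<Rightarrow> xvar list" where
  "square_word f = concat (map (\<lambda>i. square_power i (Poly_Mapping.lookup f i)) [0, 1, 2, 3])"

lemma square_pair_invariants: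
  "turns (square_pair i) = 0" "cocycle (square_pair i) j = 2 * of_bool (j = i)"
proof -
  have "\<forall>i. turns (square_pair i) = 0" unfolding forall_numeral_4 by simp
  then show "turns (square_pair i) = 0" by blast
  have "\<forall>i j. cocycle (square_pair i) j = 2 * of_bool (j = i)"
    unfolding forall_numeral_4 by simp
  then show "cocycle (square_pair i) j = 2 * of_bool (j = i)" by blast
qed

text \<open>Factors of turn zero do not rotate what follows them, so their cocycles simply
  add.\<close>

lemma square_power_invariants:
  "turns (square_power i n) = 0" "cocycle (square_power i n) j = 2 * n * of_bool (j = i)"
proof -
  have *: "square_power i (Suc n) = square_pair i @ square_power i n" for n
    by (simp add: square_power_def)
  show t: "turns (square_power i n) = 0"
    by (induction n) (simp add: square_power_def, simp only: * turns_simps square_pair_invariants add_0)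
  show "cocycle (square_power i n) j = 2 * n * of_bool (j = i)"
  proof (induction n)
    case (Suc n)
    then show ?case
      unfolding * cocycle_append square_pair_invariants diff_0_right by (simp add: algebra_simps)
  qed (simp add: square_power_def)
qed

lemma cocycle_square_word: "cocycle (square_word f) = (\<lambda>j. 2 * Poly_Mapping.lookup f j)"
proof -
  have "\<forall>j. cocycle (square_word f) j = 2 * Poly_Mapping.lookup f j"
    unfolding forall_numeral_4
    by (simp add: square_word_def cocycle_append square_power_invariants)
  then show ?thesis by blast
qed

section \<open>Degrees of words\<close>

lemma equiv_pres_rel: "equiv UNIV (pres_rel S)"
  by (rule equivI)
    (auto simp: refl_on_def sym_def trans_def intro: pres_rel.refl pres_rel.sym pres_rel.trans)

lemma pres_rel_append:
  assumes "(u, u') \<in> pres_rel S" "(v, v') \<in> pres_rel S"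
  shows "(u @ v, u' @ v') \<in> pres_rel S"
  using pres_rel.cong[OF assms(1), of "[]" v] pres_rel.cong[OF assms(2), of u' "[]"]
  by (auto intro: pres_rel.trans)

text \<open>By congruence all choices of representatives give the same class, so the double union
  defining the product collapses to it.\<close>

lemma presented_group_mult_class:
  "pres_rel S `` {u} \<otimes>\<^bsub>presented_group S\<^esub> pres_rel S `` {v} = pres_rel S `` {u @ v}"
proof -
  have "(\<Union>u'\<in>pres_rel S `` {u}. \<Union>v'\<in>pres_rel S `` {v}. pres_rel S `` {u' @ v'}) =
      pres_rel S `` {u @ v}" (is "?L = ?R")
  proof
    show "?L \<subseteq> ?R" using pres_rel.trans[OF pres_rel_append] by blast
    show "?R \<subseteq> ?L" using pres_rel.refl[of u S] pres_rel.refl[of v S] by blast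
  qed
  then show ?thesis by (simp add: presented_group_def)
qed

fun degree_word :: "xvar \<Rightarrow> m16_gen gword" where
  "degree_word X1 = [(Ga, True)]"
| "degree_word X2 = [(Ga, True), (Gc, True), (Gd, True)]"
| "degree_word X3 = [(Ga, True), (Gb, True)]"
| "degree_word X4 = [(Ga, True), (Gb, True), (Gc, True)]"

lemma var_degree_class: "var_degree v = pres_rel m16_relations `` {degree_word v}"
  by (cases v) (simp_all add: M16_def m16_def presented_group_mult_class)

lemma word_degree_class:
  "word_degree (Word w) = pres_rel m16_relations `` {concat (map degree_word w)}"
proof (induction w)
  case Nil
  show ?case by (simp add: word_degree_def M16_def presented_group_def)
next
  case (Cons v w)
  then show ?case
    by (simp add: word_degree_def M16_def var_degree_class presented_group_mult_class)
qed

lemma word_degree_eq_one_iff: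
  "word_degree (Word w) = \<one>\<^bsub>M16\<^esub> \<longleftrightarrow> (concat (map degree_word w), []) \<in> pres_rel m16_relations"
proof -
  have one: "\<one>\<^bsub>M16\<^esub> = pres_rel m16_relations `` {[]}"
    by (simp add: M16_def presented_group_def)
  show ?thesis
    unfolding word_degree_class one by (simp add: eq_equiv_class_iff[OF equiv_pres_rel])
qed

lemma word_degree_zero: "word_degree 0 = \<one>\<^bsub>M16\<^esub>"
  by (simp add: zero_word_def word_degree_eq_one_iff pres_rel.refl)

lemma word_degree_add_eq_one:
  assumes "word_degree u = \<one>\<^bsub>M16\<^esub>" "word_degree v = \<one>\<^bsub>M16\<^esub>"
  shows "word_degree (u + v) = \<one>\<^bsub>M16\<^esub>"
  using assms pres_rel_append[where u' = "[]" and v' = "[]"]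
  by (cases u; cases v) (simp add: plus_word_def word_degree_eq_one_iff)

text \<open>The left-hand words are the degrees of the four elements of \<open>Y\<close>. All reduce
  to \<open>c c d = d d = e\<close>: centrality moves \<open>c\<close> and \<open>d\<close> to the
  right, and \<open>b a = a b d\<close> brings the two letters \<open>b\<close> together.\<close>

lemma m16_word_identities:
  fixes a b c d :: "m16_gen \<times> bool"
  defines "a \<equiv> (Ga, True)" and "b \<equiv> (Gb, True)" and "c \<equiv> (Gc, True)" and "d \<equiv> (Gd, True)"
  shows "([a, a, c, d], []) \<in> pres_rel m16_relations"
    and "([a, c, d, a], []) \<in> pres_rel m16_relations"
    and "([a, b, a, b, c], []) \<in> pres_rel m16_relations"
    and "([a, b, c, a, b], []) \<in> pres_rel m16_relations"
proof -
  let ?R = "pres_rel m16_relations"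
  have relation: "(p @ u @ q, p @ v @ q) \<in> ?R" if "(u, v) \<in> m16_relations" for u v p q
    using that by (intro pres_rel.cong pres_rel.rel)
  have aa: "(p @ [a, a] @ q, p @ [c] @ q) \<in> ?R"
    and bb: "(p @ [b, b] @ q, p @ [] @ q) \<in> ?R"
    and dd: "(p @ [d, d] @ q, p @ [] @ q) \<in> ?R"
    and cc: "(p @ [c, c] @ q, p @ [d] @ q) \<in> ?R"
    and ca: "(p @ [c, a] @ q, p @ [a, c] @ q) \<in> ?R"
    and cb: "(p @ [c, b] @ q, p @ [b, c] @ q) \<in> ?R"
    and da: "(p @ [d, a] @ q, p @ [a, d] @ q) \<in> ?R"
    and db: "(p @ [d, b] @ q, p @ [b, d] @ q) \<in> ?R"
    and dc: "(p @ [d, c] @ q, p @ [c, d] @ q) \<in> ?R"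
    and conj: "(p @ [(Ga, False), b, a] @ q, p @ [b, d] @ q) \<in> ?R" for p q
    by (rule relation; auto simp: m16_relations_def Let_def a_def b_def c_def d_def)+
  \<comment> \<open>Inserting \<open>a\<close> and its inverse in front of \<open>b a\<close>
    exposes the conjugation relation.\<close>
  have ba: "(p @ [b, a] @ q, p @ [a, b, d] @ q) \<in> ?R" for p q
  proof -
    have "([a, (Ga, False)], []) \<in> ?R"
      using pres_rel.cancel[of Ga True] by (simp add: a_def)
    from pres_rel.cong[OF pres_rel.sym[OF this], of p "[b, a] @ q"]
    have "(p @ [b, a] @ q, (p @ [a]) @ [(Ga, False), b, a] @ q) \<in> ?R" by simp
    from pres_rel.trans[OF this conj] show ?thesis by simp
  qed
  note [trans] = pres_rel.trans
  have ccd: "([c, c, d], []) \<in> ?R"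
    using pres_rel.trans[OF cc[of "[]" "[d]"]] dd[of "[]" "[]"] by simp
  show 1: "([a, a, c, d], []) \<in> ?R"
    using pres_rel.trans[OF aa[of "[]" "[c, d]"]] ccd by simp
  have "([a, c, d, a], [a, c, a, d]) \<in> ?R" using da[of "[a, c]" "[]"] by simp
  also have "([a, c, a, d], [a, a, c, d]) \<in> ?R" using ca[of "[a]" "[d]"] by simp
  also note 1
  finally show "([a, c, d, a], []) \<in> ?R" .
  show 3: "([a, b, a, b, c], []) \<in> ?R"
  proof -
    have "([a, b, a, b, c], [a, a, b, d, b, c]) \<in> ?R" using ba[of "[a]" "[b, c]"] by simp
    also have "([a, a, b, d, b, c], [a, a, b, b, d, c]) \<in> ?R"
      using db[of "[a, a, b]" "[c]"] by simp
    also have "([a, a, b, b, d, c], [a, a, d, c]) \<in> ?R" using bb[of "[a, a]" "[d, c]"] by simp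
    also have "([a, a, d, c], [c, d, c]) \<in> ?R" using aa[of "[]" "[d, c]"] by simp
    also have "([c, d, c], [c, c, d]) \<in> ?R"
      using dc[of "[c]" "[]"] by simp
    also note ccd
    finally show ?thesis .
  qed
  have "([a, b, c, a, b], [a, b, a, c, b]) \<in> ?R" using ca[of "[a, b]" "[b]"] by simp
  also have "([a, b, a, c, b], [a, b, a, b, c]) \<in> ?R" using cb[of "[a, b, a]" "[]"] by simp
  also note 3
  finally show "([a, b, c, a, b], []) \<in> ?R" .
qed

lemma word_degree_square_pair: "word_degree (Word (square_pair i)) = \<one>\<^bsub>M16\<^esub>"
  using m16_word_identities by (auto simp: word_degree_eq_one_iff)

lemma word_degree_concat_eq_one:
  "(\<And>w. w \<in> set ws \<Longrightarrow> word_degree (Word w) = \<one>\<^bsub>M16\<^esub>) \<Longrightarrow>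
    word_degree (Word (concat ws)) = \<one>\<^bsub>M16\<^esub>"
proof (induction ws)
  case Nil
  then show ?case using word_degree_zero by (simp add: zero_word_def)
next
  case (Cons w ws)
  then show ?case
    using word_degree_add_eq_one[of "Word w" "Word (concat ws)"] by (simp add: plus_word_def)
qed

lemma word_degree_square_word: "word_degree (Word (square_word f)) = \<one>\<^bsub>M16\<^esub>"
proof -
  have "word_degree (Word (square_power i n)) = \<one>\<^bsub>M16\<^esub>" for i n
    unfolding square_power_def
    by (rule word_degree_concat_eq_one) (simp add: word_degree_square_pair del: square_pair.simps)
  then show ?thesis
    unfolding square_word_def by (intro word_degree_concat_eq_one) auto
qed

text \<open>
  The action of \<open>M\<^sub>1\<^sub>6\<close> on cocycles modulo \<open>2\<close> (paired with turns) for which the degree of a letter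
  acts as the letter itself; \<open>X1\<close> gives \<open>a\<close>, and \<open>X3\<close> then determines \<open>b\<close>.
\<close>

fun m16_act :: "m16_gen \<times> bool \<Rightarrow> (4 \<Rightarrow> bool) \<times> 4 \<Rightarrow> (4 \<Rightarrow> bool) \<times> 4" where
  "m16_act (Ga, True) (f, s) = (\<lambda>j. (j = 1) \<noteq> f (j + 1), s - 1)"
| "m16_act (Ga, False) (f, s) = (\<lambda>j. (j = 2) \<noteq> f (j - 1), s + 1)"
| "m16_act (Gb, _) (f, s) = (\<lambda>j. (j = 0 \<or> j = 2) \<noteq> f j, s)"
| "m16_act (Gc, True) (f, s) = (\<lambda>j. (j = 0 \<or> j = 1) \<noteq> f (j + 2), s + 2)"
| "m16_act (Gc, False) (f, s) = (\<lambda>j. (j = 2 \<or> j = 3) \<noteq> f (j + 2), s + 2)"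
| "m16_act (Gd, _) (f, s) = (\<lambda>j. \<not> f j, s)"

lemma fun4_eq_iff: "f = g \<longleftrightarrow> f 0 = g 0 \<and> f 1 = g 1 \<and> f 2 = g 2 \<and> f (3::4) = g 3"
  unfolding fun_eq_iff forall_numeral_4 ..

lemma numeral_4_simps:
  "(4 :: 4) = 0" "(5 :: 4) = 1" "(6 :: 4) = 2" "(- 1 :: 4) = 3" "(- 2 :: 4) = 2" "(- 3 :: 4) = 1"
  by simp_all

text \<open>Each defining relation is checked as an identity of maps, so the action of a word
  depends only on the element of \<open>M16\<close> it represents.\<close>

lemma m16_act_respects_pres_rel:
  "(u, v) \<in> pres_rel m16_relations \<Longrightarrow> foldr m16_act u = foldr m16_act v"
proof (induction rule: pres_rel.induct)
  case (rel u v)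
  have central: "m16_act z (m16_act (g, True) (f, s)) = m16_act (g, True) (m16_act z (f, s))"
    if "z = (Gc, True) \<or> z = (Gd, True)" for z g f s
    using that by (cases g) (auto simp: fun4_eq_iff numeral_4_simps)
  from rel consider "u = [(Ga, True), (Ga, True)]" "v = [(Gc, True)]"
    | "u = [(Gb, True), (Gb, True)]" "v = []" | "u = [(Gd, True), (Gd, True)]" "v = []"
    | "u = [(Gc, True), (Gc, True)]" "v = [(Gd, True)]"
    | "u = [(Ga, False), (Gb, True), (Ga, True)]" "v = [(Gb, True), (Gd, True)]"
    | z g where "z = (Gc, True) \<or> z = (Gd, True)" "u = [z, (g, True)]" "v = [(g, True), z]"
    unfolding m16_relations_def Let_def by blast
  then have "foldr m16_act u (f, s) = foldr m16_act v (f, s)" for f s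
    by cases (simp_all add: fun4_eq_iff numeral_4_simps central)
  then show ?case by (auto simp: fun_eq_iff)
next
  case (cancel x b)
  have "foldr m16_act [(x, b), (x, \<not> b)] (f, s) = (f, s)" for f s
    by (cases x; cases b) (auto simp: fun4_eq_iff numeral_4_simps)
  then show ?case by (auto simp: fun_eq_iff)
qed (simp_all add: comp_def)

lemma m16_act_degree_word:
  "foldr m16_act (degree_word v) (f, s) =
    (\<lambda>j. (j = var_index v) \<noteq> f (j - var_turn v), s + var_turn v)"
  by (cases v) (auto simp: fun4_eq_iff numeral_4_simps)

text \<open>The invariants are read off from the image of a base point. Under \<open>foldr\<close>
  the first letter acts last, just as \<open>cocycle\<close> rotates the cocycle of the tail by the
  first letter.\<close>

lemma m16_act_degree:
  "foldr m16_act (concat (map degree_word w)) (\<lambda>_. False, 0) = (\<lambda>j. odd (cocycle w j), turns w)"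
  by (induction w) (auto simp: m16_act_degree_word fun_eq_iff algebra_simps)

text \<open>A word of degree \<open>e\<close> acts as the identity and therefore fixes the base
  point.\<close>

lemma word_degree_eq_oneD:
  assumes "word_degree (Word w) = \<one>\<^bsub>M16\<^esub>"
  shows "even (cocycle w j)" "turns w = 0"
proof -
  have "foldr m16_act (concat (map degree_word w)) = id"
    using assms by (auto simp: word_degree_eq_one_iff dest: m16_act_respects_pres_rel)
  with m16_act_degree[of w] have "(\<lambda>j. odd (cocycle w j), turns w) = (\<lambda>_. False, 0)" by simp
  then show "even (cocycle w j)" "turns w = 0" by (auto simp: fun_eq_iff)
qed

section \<open>The algebra and its identity component\<close>

lemma poly_mapping_sum_singles: "p = (\<Sum>k\<in>Poly_Mapping.keys p. Poly_Mapping.single k (Poly_Mapping.lookup p k))"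
  by (rule poly_mapping_eqI)
    (simp add: Poly_Mapping.lookup_sum lookup_single when_def in_keys_iff)

text \<open>Reduces additive statements about elements supported in \<open>A\<close> to single
  terms.\<close>

lemma poly_mapping_keys_induct [consumes 1, case_names zero single add]:
  fixes p :: "'a \<Rightarrow>\<^sub>0 'b::comm_monoid_add"
  assumes "Poly_Mapping.keys p \<subseteq> A"
    and "P 0"
    and "\<And>k c. k \<in> A \<Longrightarrow> P (Poly_Mapping.single k c)"
    and "\<And>p q. P p \<Longrightarrow> P q \<Longrightarrow> P (p + q)"
  shows "P p"
proof -
  have "P (\<Sum>k\<in>B. Poly_Mapping.single k (Poly_Mapping.lookup p k))" if "finite B" "B \<subseteq> A" for B
    using that by (induction B rule: finite_induct) (auto intro: assms)
  from this[OF finite_keys assms(1)] show ?thesis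
    using poly_mapping_sum_singles[of p] by simp
qed

text \<open>Scalars act by convolution with the constants
  \<open>Poly_Mapping.single 0 c\<close>.\<close>

definition linear_extension ::
    "('a \<Rightarrow> 'm::monoid_add \<Rightarrow>\<^sub>0 'k::ring_1) \<Rightarrow> ('a \<Rightarrow>\<^sub>0 'k) \<Rightarrow> 'm \<Rightarrow>\<^sub>0 'k" where
  "linear_extension B p =
     (\<Sum>k\<in>Poly_Mapping.keys p. Poly_Mapping.single 0 (Poly_Mapping.lookup p k) * B k)"

lemma linear_extension_single [simp]:
  "linear_extension B (Poly_Mapping.single k c) = Poly_Mapping.single 0 c * B k"
  by (simp add: linear_extension_def)

lemma linear_extension_zero [simp]: "linear_extension B 0 = 0"
  by (simp add: linear_extension_def)

lemma linear_extension_superset: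
  assumes "finite A" "Poly_Mapping.keys p \<subseteq> A"
  shows "linear_extension B p = (\<Sum>k\<in>A. Poly_Mapping.single 0 (Poly_Mapping.lookup p k) * B k)"
  unfolding linear_extension_def using assms
  by (intro sum.mono_neutral_left) (auto simp: in_keys_iff)

lemma linear_extension_add [simp]:
  "linear_extension B (p + q) = linear_extension B p + linear_extension B q"
proof -
  let ?A = "Poly_Mapping.keys p \<union> Poly_Mapping.keys q"
  have "Poly_Mapping.keys (p + q) \<subseteq> ?A" by (rule keys_add)
  then show ?thesis
    by (simp add: linear_extension_superset[of ?A] lookup_add single_add distrib_right sum.distrib)
qed

lemma linear_extension_diff [simp]:
  "linear_extension B (p - q) = linear_extension B p - linear_extension B q"
  using linear_extension_add[of B "p - q" q] by (simp add: algebra_simps)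

section \<open>The quotient ring \<open>R\<close>\<close>

abbreviation monomial :: "xvar list \<Rightarrow> 'k::field free_alg" where
  "monomial w \<equiv> Poly_Mapping.single (Word w) 1"

lemma monomial_mult: "monomial u * monomial v = monomial (u @ v)"
  by (simp add: mult_single plus_word_def)

lemma R_relators_eq: "R_relators = {monomial u - monomial v | u v. (u, v) \<in> quadratic_relations}"
proof -
  have "R_relators = (\<lambda>(u, v). monomial u - monomial v) ` quadratic_relations"
    by (simp add: R_relators_def quadratic_relations_def free_var_def power2_eq_square monomial_mult)
  then show ?thesis by force
qed

lemma ring_of_type_algebra_simps [simp]:
  "carrier ring_of_type_algebra = UNIV"
  "x \<oplus>\<^bsub>ring_of_type_algebra\<^esub> y = x + y" "x \<otimes>\<^bsub>ring_of_type_algebra\<^esub> y = x * y"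
  "\<zero>\<^bsub>ring_of_type_algebra\<^esub> = 0" "\<one>\<^bsub>ring_of_type_algebra\<^esub> = 1"
  by (simp_all add: ring_of_type_algebra_def)

lemma ring_of_type_algebra_ring: "ring (ring_of_type_algebra :: 'a::ring_1 ring)"
proof -
  have "\<exists>y. y + x = 0 \<and> x + y = 0" for x :: 'a
    by (rule exI[of _ "- x"]) simp
  then show ?thesis by unfold_locales (auto simp: algebra_simps Units_def)
qed

lemma ring_of_type_algebra_minus [simp]:
  "\<ominus>\<^bsub>ring_of_type_algebra\<^esub> x = - (x :: 'a::ring_1)"
proof -
  interpret ring "ring_of_type_algebra :: 'a ring" by (rule ring_of_type_algebra_ring)
  show ?thesis by (rule minus_equality) simp_all
qed

lemma ideal_R_ideal: "ideal (R_ideal :: 'k::field free_alg set) ring_of_type_algebra"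
  unfolding R_ideal_def by (rule ring.genideal_ideal[OF ring_of_type_algebra_ring]) simp

lemma R_ideal_closed:
  fixes p q r :: "'k::field free_alg"
  shows "0 \<in> (R_ideal :: 'k free_alg set)"
    and "p \<in> R_ideal \<Longrightarrow> q \<in> R_ideal \<Longrightarrow> p + q \<in> R_ideal"
    and "p \<in> R_ideal \<Longrightarrow> - p \<in> R_ideal"
    and "p \<in> R_ideal \<Longrightarrow> r * p \<in> R_ideal"
    and "p \<in> R_ideal \<Longrightarrow> p * r \<in> R_ideal"
proof -
  have sub: "additive_subgroup (R_ideal :: 'k free_alg set) ring_of_type_algebra"
    using ideal_R_ideal by (rule ideal.axioms)
  show "0 \<in> (R_ideal :: 'k free_alg set)"
    and "p \<in> R_ideal \<Longrightarrow> q \<in> R_ideal \<Longrightarrow> p + q \<in> R_ideal"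
    and "p \<in> R_ideal \<Longrightarrow> - p \<in> R_ideal"
    using additive_subgroup.zero_closed[OF sub] additive_subgroup.a_closed[OF sub, of p q]
      additive_subgroup.a_inv_closed[OF sub, of p] by simp_all
  show "p \<in> R_ideal \<Longrightarrow> r * p \<in> R_ideal" and "p \<in> R_ideal \<Longrightarrow> p * r \<in> R_ideal"
    using ideal.I_l_closed[OF ideal_R_ideal, of p r] ideal.I_r_closed[OF ideal_R_ideal, of p r]
    by simp_all
qed

lemma R_class_eq_iff: "R_class p = R_class q \<longleftrightarrow> p - q \<in> R_ideal"
  using ring.quotient_eq_iff_same_a_r_cos[OF ring_of_type_algebra_ring ideal_R_ideal, of p q]
  by (simp add: R_class_def a_minus_def)

lemma R_alg_simps [simp]:
  "carrier R_alg = range R_class"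
  "R_class p \<oplus>\<^bsub>R_alg\<^esub> R_class q = R_class (p + q)"
  "R_class p \<otimes>\<^bsub>R_alg\<^esub> R_class q = R_class (p * q)"
  "\<one>\<^bsub>R_alg\<^esub> = R_class 1" "\<zero>\<^bsub>R_alg\<^esub> = R_class 0"
proof -
  note hom = ideal.rcos_ring_hom[OF ideal_R_ideal]
  show "R_class p \<oplus>\<^bsub>R_alg\<^esub> R_class q = R_class (p + q)"
    "R_class p \<otimes>\<^bsub>R_alg\<^esub> R_class q = R_class (p * q)"
    using ring_hom_add[OF hom, of p q] ring_hom_mult[OF hom, of p q]
    by (simp_all add: R_alg_def R_class_def)
  show "\<one>\<^bsub>R_alg\<^esub> = R_class 1"
    by (simp add: R_alg_def R_class_def FactRing_def)
  show "carrier R_alg = range R_class"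
    by (auto simp: R_alg_def R_class_def FactRing_def A_RCOSETS_def')
  show "\<zero>\<^bsub>R_alg\<^esub> = R_class 0"
    by (simp add: R_alg_def R_class_def FactRing_def
        ring.a_rcos_zero[OF ring_of_type_algebra_ring ideal_R_ideal R_ideal_closed(1)])
qed

lemma ring_R_alg: "ring (R_alg :: 'k::field free_alg set ring)"
  unfolding R_alg_def by (rule ideal.quotient_is_ring[OF ideal_R_ideal])

lemma R_alg_minus [simp]: "\<ominus>\<^bsub>R_alg\<^esub> R_class p = R_class (- p)"
  by (rule abelian_group.minus_equality[OF ring.is_abelian_group[OF ring_R_alg]]) simp_all

text \<open>The rules of the congruence mirror closure properties of the ideal: symmetry is
  negation, transitivity a telescoping sum, and context is multiplication by monomials on both
  sides.\<close>

lemma word_eq_imp_R_ideal: "word_eq u v \<Longrightarrow> monomial u - monomial v \<in> R_ideal"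
proof (induction rule: word_eq.induct)
  case (rel u v)
  then show ?case
    unfolding R_ideal_def using ring.genideal_self[OF ring_of_type_algebra_ring, of R_relators] R_relators_eq by fastforce
next
  case (sym u v)
  then show ?case using R_ideal_closed(3) by fastforce
next
  case (trans u v w)
  then show ?case using R_ideal_closed(2) by fastforce
next
  case (cong u v p q)
  have "monomial (p @ u @ q) - monomial (p @ v @ q) =
      monomial p * (monomial u - monomial v) * (monomial q :: 'a free_alg)"
    by (simp add: algebra_simps monomial_mult)
  then show ?case using R_ideal_closed(4,5) cong by metis
qed (simp add: R_ideal_closed)

section \<open>Linear maps between the free algebra and the polynomial ring\<close>

definition half_cocycle :: "xvar list \<Rightarrow> 4 \<Rightarrow>\<^sub>0 nat" where
  "half_cocycle w = Abs_poly_mapping (\<lambda>j. cocycle w j div 2)"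

lemma lookup_half_cocycle [simp]: "Poly_Mapping.lookup (half_cocycle w) j = cocycle w j div 2"
  by (simp add: half_cocycle_def)

text \<open>The value on a word depends only on its cocycle, so relations are respected. The map is
  linear but not multiplicative: \<open>X1\<close> and \<open>X2\<close> go to 0, while their
  product goes to a variable.\<close>

definition to_poly4 :: "'k::field free_alg \<Rightarrow> 'k poly4" where
  "to_poly4 = linear_extension (\<lambda>w. if \<forall>j. even (cocycle (letters w) j)
     then Poly_Mapping.single (half_cocycle (letters w)) 1 else 0)"

text \<open>A linear right inverse of \<open>to_poly4\<close>, given by normal words.\<close>

definition from_poly4 :: "'k::field poly4 \<Rightarrow> 'k free_alg" where
  "from_poly4 = linear_extension (\<lambda>f. monomial (square_word f))"

lemma to_poly4_simps [simp]:
  "to_poly4 0 = 0" "to_poly4 (p + q) = to_poly4 p + to_poly4 q"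
  "to_poly4 (p - q) = to_poly4 p - to_poly4 q"
  by (simp_all add: to_poly4_def)

lemma from_poly4_simps [simp]:
  "from_poly4 0 = 0" "from_poly4 (p + q) = from_poly4 p + from_poly4 q"
  "from_poly4 (Poly_Mapping.single f c) = Poly_Mapping.single (Word (square_word f)) c"
  by (simp_all add: from_poly4_def mult_single)

lemma to_poly4_single:
  "to_poly4 (Poly_Mapping.single w c) = (if \<forall>j. even (cocycle (letters w) j)
     then Poly_Mapping.single (half_cocycle (letters w)) c else 0)"
  by (simp add: to_poly4_def mult_single)

lemma to_poly4_const: "to_poly4 (Poly_Mapping.single 0 c) = Poly_Mapping.single 0 c"
proof -
  have "half_cocycle [] = 0" by (rule poly_mapping_eqI) simp
  then show ?thesis by (simp add: to_poly4_single zero_word_def)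
qed

lemma to_poly4_one: "to_poly4 1 = 1"
  using to_poly4_const[of 1] by simp

lemma to_poly4_single_cong:
  assumes "cocycle (letters u) = cocycle (letters v)"
  shows "to_poly4 (Poly_Mapping.single u c) = to_poly4 (Poly_Mapping.single v c)"
  using assms by (simp add: to_poly4_single half_cocycle_def)

text \<open>By linearity in \<open>x\<close> and \<open>y\<close>, single terms suffice. The two
  sides of a relation have the same cocycle and the same turn; the latter keeps the rotation of the
  right-hand context unchanged.\<close>

lemma to_poly4_relator:
  assumes "(u, v) \<in> quadratic_relations"
  shows "to_poly4 (x * (monomial u - monomial v) * y) = 0"
proof -
  have *: "to_poly4 (Poly_Mapping.single s a * (monomial u - monomial v) * Poly_Mapping.single t b) = 0"
    for s t and a b :: 'a
  proof -
    have "cocycle (letters (s + Word u + t)) = cocycle (letters (s + Word v + t))"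
      using quadratic_relations_invariant[OF assms]
      by (simp add: plus_word_def cocycle_append fun_eq_iff)
    from to_poly4_single_cong[OF this, of "a * b"] show ?thesis
      by (simp add: left_diff_distrib right_diff_distrib mult_single)
  qed
  have **: "to_poly4 (x * (monomial u - monomial v) * Poly_Mapping.single t b) = 0" for t and b :: 'a
    using subset_UNIV[of "Poly_Mapping.keys x"]
    \<comment> \<open>Dropping the rule for differences keeps the relator whole, so that
      \<open>*\<close> applies.\<close>
    by (induction x rule: poly_mapping_keys_induct) (simp_all add: * distrib_right del: to_poly4_simps(3))
  show ?thesis
    using subset_UNIV[of "Poly_Mapping.keys y"]
    by (induction y rule: poly_mapping_keys_induct) (simp_all add: ** distrib_left)
qed

lemma to_poly4_R_ideal:
  fixes p :: "'k::field free_alg"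
  assumes "p \<in> R_ideal"
  shows "to_poly4 p = 0"
proof -
  \<comment> \<open>The kernel of the linear map \<^const>\<open>to_poly4\<close> is not an ideal, so pass to the largest ideal inside it.\<close>
  let ?K = "{p :: 'k free_alg. \<forall>x y. to_poly4 (x * p * y) = 0}"
  have "ideal ?K ring_of_type_algebra"
  proof (rule idealI[OF ring_of_type_algebra_ring])
    show "subgroup ?K (add_monoid ring_of_type_algebra)"
    proof
      fix p assume p: "p \<in> ?K"
      have "to_poly4 (x * (- p) * y) = 0" for x y
        using p to_poly4_simps(3)[of 0 "x * p * y"] by simp
      then show "inv\<^bsub>add_monoid ring_of_type_algebra\<^esub> p \<in> ?K"
        using ring_of_type_algebra_minus[of p] by (simp add: a_inv_def)
    qed (auto simp: distrib_left distrib_right)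
  next
    fix p r assume p: "p \<in> ?K"
    show "r \<otimes>\<^bsub>ring_of_type_algebra\<^esub> p \<in> ?K"
      using p by (simp add: mult.assoc[symmetric])
    have "to_poly4 (x * (p * r) * y) = to_poly4 (x * p * (r * y))" for x y
      by (simp add: mult.assoc)
    with p show "p \<otimes>\<^bsub>ring_of_type_algebra\<^esub> r \<in> ?K" by simp
  qed
  moreover have "R_relators \<subseteq> ?K" by (auto simp: R_relators_eq to_poly4_relator)
  ultimately have "R_ideal \<subseteq> ?K" unfolding R_ideal_def by (rule ring.genideal_minimal[OF ring_of_type_algebra_ring])
  then have "to_poly4 (1 * p * 1) = 0" using assms by blast
  then show ?thesis by simp
qed

lemma to_poly4_from_poly4 [simp]: "to_poly4 (from_poly4 q) = q"
  using subset_UNIV[of "Poly_Mapping.keys q"]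
proof (induction q rule: poly_mapping_keys_induct)
  case (single f c)
  have "half_cocycle (square_word f) = f" by (rule poly_mapping_eqI) (simp add: cocycle_square_word)
  then show ?case by (simp add: to_poly4_single cocycle_square_word)
qed simp_all

section \<open>Elements of degree \<open>e\<close>\<close>

abbreviation degree_one_words :: "xvar word set" where
  "degree_one_words \<equiv> {w. word_degree w = \<one>\<^bsub>M16\<^esub>}"

definition degree_one_polys :: "'k::field free_alg set" where
  "degree_one_polys = {p. Poly_Mapping.keys p \<subseteq> degree_one_words}"

lemma R_component_one: "R_component \<one>\<^bsub>M16\<^esub> = R_class ` degree_one_polys"
  by (auto simp: R_component_def degree_one_polys_def)

lemma degree_one_polys_closed:
  "1 \<in> degree_one_polys" "Poly_Mapping.single 0 c \<in> degree_one_polys"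
  "p \<in> degree_one_polys \<Longrightarrow> q \<in> degree_one_polys \<Longrightarrow> p + q \<in> degree_one_polys"
  "p \<in> degree_one_polys \<Longrightarrow> q \<in> degree_one_polys \<Longrightarrow> p * q \<in> degree_one_polys"
  "r \<in> degree_one_polys \<Longrightarrow> - r \<in> degree_one_polys"
proof -
  show "1 \<in> degree_one_polys" "Poly_Mapping.single 0 c \<in> degree_one_polys"
    by (simp_all add: degree_one_polys_def word_degree_zero)
  show "r \<in> degree_one_polys \<Longrightarrow> - r \<in> degree_one_polys"
    by (auto simp: degree_one_polys_def in_keys_iff)
  show "p + q \<in> degree_one_polys" if "p \<in> degree_one_polys" "q \<in> degree_one_polys"
    using that keys_add[of p q] unfolding degree_one_polys_def by blast
  show "p * q \<in> degree_one_polys" if "p \<in> degree_one_polys" "q \<in> degree_one_polys"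
    using that keys_mult[of p q] word_degree_add_eq_one unfolding degree_one_polys_def by blast
qed

lemma from_poly4_degree_one: "from_poly4 q \<in> degree_one_polys"
  using subset_UNIV[of "Poly_Mapping.keys q"]
proof (induction q rule: poly_mapping_keys_induct)
  case (single f c)
  then show ?case by (simp add: degree_one_polys_def word_degree_square_word)
next
  case (add p q)
  then show ?case using degree_one_polys_closed(3) by simp
qed (simp add: degree_one_polys_def)

text \<open>A word of degree \<open>e\<close> has an even cocycle, so it shares its cocycle with the
  normal word of its halved cocycle; the two are then equal in \<open>R\<close>.\<close>

lemma from_poly4_to_poly4:
  assumes "p \<in> degree_one_polys"
  shows "R_class (from_poly4 (to_poly4 p)) = R_class p"
proof -
  have "from_poly4 (to_poly4 p) - p \<in> R_ideal"
    using assms unfolding degree_one_polys_def mem_Collect_eq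
  proof (induction p rule: poly_mapping_keys_induct)
    case (single w c)
    obtain w' where w: "w = Word w'" by (cases w)
    have ev: "\<forall>j. even (cocycle w' j)" using single w word_degree_eq_oneD by blast
    then have "word_eq (square_word (half_cocycle w')) w'"
      by (intro word_eq_if_cocycle_eq) (auto simp: cocycle_square_word)
    then have "Poly_Mapping.single 0 c * (monomial (square_word (half_cocycle w')) - monomial w') \<in> R_ideal"
      by (intro R_ideal_closed word_eq_imp_R_ideal)
    then show ?case using ev w by (simp add: to_poly4_single right_diff_distrib mult_single)
  next
    case (add p q)
    from R_ideal_closed(2)[OF this] show ?case by (simp add: algebra_simps)
  qed (simp add: R_ideal_closed)
  then show ?thesis by (simp add: R_class_eq_iff)
qed

text \<open>Words of degree \<open>e\<close> have turn zero, so cocycles add under concatenation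
  without rotation; being even, their halves add as well.\<close>

lemma to_poly4_mult:
  assumes "p \<in> degree_one_polys" "q \<in> degree_one_polys"
  shows "to_poly4 (p * q) = to_poly4 p * to_poly4 q"
proof -
  have s: "to_poly4 (Poly_Mapping.single u a * Poly_Mapping.single v b) =
      to_poly4 (Poly_Mapping.single u a) * to_poly4 (Poly_Mapping.single v b)"
    if uv: "u \<in> degree_one_words" "v \<in> degree_one_words" for u v and a b :: 'a
  proof -
    obtain u' v' where w: "u = Word u'" "v = Word v'" by (cases u; cases v)
    have u: "even (cocycle u' j)" "turns u' = 0" and v: "even (cocycle v' j)" for j
      using uv w word_degree_eq_oneD by blast+
    have "half_cocycle (u' @ v') = half_cocycle u' + half_cocycle v'"
      by (rule poly_mapping_eqI) (simp add: lookup_add cocycle_append u v)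
    then show ?thesis
      by (simp add: w mult_single to_poly4_single plus_word_def cocycle_append u v)
  qed
  have "to_poly4 (p * Poly_Mapping.single v b) = to_poly4 p * to_poly4 (Poly_Mapping.single v b)"
    if "v \<in> degree_one_words" for v b
    using assms(1) unfolding degree_one_polys_def mem_Collect_eq
    by (induction p rule: poly_mapping_keys_induct) (use s that in \<open>auto simp: distrib_right\<close>)
  with assms(2)[unfolded degree_one_polys_def mem_Collect_eq] show ?thesis
    by (induction q rule: poly_mapping_keys_induct) (auto simp: distrib_left)
qed

section \<open>Generation by \<open>Y\<close> and the isomorphism with the polynomial ring\<close>

abbreviation square_generators :: "'k::field free_alg set set" where
  "square_generators \<equiv> {R_var X1 \<otimes>\<^bsub>R_alg\<^esub> R_var X2, R_var X2 \<otimes>\<^bsub>R_alg\<^esub> R_var X1,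
     R_var X3 \<otimes>\<^bsub>R_alg\<^esub> R_var X4, R_var X4 \<otimes>\<^bsub>R_alg\<^esub> R_var X3}"

lemma square_generators_eq: "square_generators = (\<lambda>i. R_class (monomial (square_pair i))) ` UNIV"
proof -
  have univ: "(UNIV :: 4 set) = {1, 2, 3, 0}"
    using forall_numeral_4[of "\<lambda>i. i \<in> {1, 2, 3, 0}"] by auto
  show ?thesis unfolding univ by (auto simp: R_var_def free_var_def monomial_mult)
qed

lemma alg_subalgebra_R_component: "alg_subalgebra R_alg R_const (R_component \<one>\<^bsub>M16\<^esub>)"
  unfolding alg_subalgebra_def R_component_one
proof
  note closed = degree_one_polys_closed
  show "subring (R_class ` degree_one_polys) R_alg"
    by (rule ring.subringI[OF ring_R_alg])
      (use closed in \<open>auto intro!: imageI\<close>)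
  show "range R_const \<subseteq> R_class ` degree_one_polys"
    using closed(2) by (auto simp: R_const_def)
qed

text \<open>Normal words are products of generators, and coefficients enter through
  \<open>R_const\<close>.\<close>

lemma from_poly4_in_subalgebra:
  assumes S: "alg_subalgebra R_alg R_const S" and Y: "square_generators \<subseteq> S"
  shows "R_class (from_poly4 q) \<in> S"
proof -
  have sub: "subring S R_alg" and const: "R_class (Poly_Mapping.single 0 c) \<in> S" for c
    using S by (auto simp: alg_subalgebra_def R_const_def)
  note closed = subringE(3,6,7)[OF sub]
  have mult: "R_class p \<in> S \<Longrightarrow> R_class q \<in> S \<Longrightarrow> R_class (p * q) \<in> S" for p q
    using closed(2)[of "R_class p" "R_class q"] by simp
  have concat: "(\<And>w. w \<in> set ws \<Longrightarrow> R_class (monomial w) \<in> S) \<Longrightarrow> R_class (monomial (concat ws)) \<in> S"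
    for ws
  proof (induction ws)
    case Nil
    then show ?case using closed(1) by (simp add: zero_word_def[symmetric])
  next
    case (Cons w ws)
    then show ?case using mult[of "monomial w" "monomial (concat ws)"] by (simp add: monomial_mult)
  qed
  have "R_class (monomial (square_pair i)) \<in> S" for i
    using Y unfolding square_generators_eq by blast
  then have "R_class (monomial (square_power i n)) \<in> S" for i n
    unfolding square_power_def by (intro concat) (simp del: square_pair.simps)
  then have word: "R_class (monomial (square_word f)) \<in> S" for f
    unfolding square_word_def by (intro concat) auto
  show ?thesis
    using subset_UNIV[of "Poly_Mapping.keys q"]
  proof (induction q rule: poly_mapping_keys_induct)
    case zero
    then show ?case using const[of 0] by simp
  next
    case (single f c)
    then show ?case using mult[OF const[of c] word[of f]] by (simp add: mult_single)
  next
    case (add p q)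
    then show ?case using closed(3)[of "R_class (from_poly4 p)" "R_class (from_poly4 q)"] by simp
  qed
qed

text \<open>The component is itself a subalgebra containing the generators; conversely, each of its
  elements is represented by a combination of normal words.\<close>

lemma R_component_generated: "R_component \<one>\<^bsub>M16\<^esub> = alg_generated R_alg R_const square_generators"
proof
  have "square_generators \<subseteq> R_component \<one>\<^bsub>M16\<^esub>"
    unfolding square_generators_eq R_component_one
    by (auto simp: degree_one_polys_def word_degree_square_pair simp del: square_pair.simps intro!: imageI)
  then show "alg_generated R_alg R_const square_generators \<subseteq> R_component \<one>\<^bsub>M16\<^esub>"
    unfolding alg_generated_def using alg_subalgebra_R_component by blast
  show "R_component \<one>\<^bsub>M16\<^esub> \<subseteq> alg_generated R_alg R_const square_generators"
  proof
    fix A assume "A \<in> R_component \<one>\<^bsub>M16\<^esub>"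
    then obtain p where "p \<in> degree_one_polys" "A = R_class p"
      unfolding R_component_one by blast
    then have "A = R_class (from_poly4 (to_poly4 p))" by (simp add: from_poly4_to_poly4)
    then show "A \<in> alg_generated R_alg R_const square_generators"
      unfolding alg_generated_def using from_poly4_in_subalgebra by blast
  qed
qed

lemma R_component_isomorphic:
  "alg_isomorphic (R_alg\<lparr>carrier := R_component \<one>\<^bsub>M16\<^esub>\<rparr>) R_const
     (poly4_ring :: 'k::field poly4 ring) poly4_const"
proof -
  \<comment> \<open>The chosen representative does not matter, since \<open>to_poly4\<close>
    vanishes on \<open>R_ideal\<close>.\<close>
  define h :: "'k free_alg set \<Rightarrow> 'k poly4" where "h A = to_poly4 (SOME p. R_class p = A)" for A
  have h: "h (R_class p) = to_poly4 p" for p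
  proof -
    have "R_class (SOME q. R_class q = R_class p) = R_class p" by (rule someI[of _ p]) (rule HOL.refl)
    then have "to_poly4 ((SOME q. R_class q = R_class p) - p) = 0"
      unfolding R_class_eq_iff by (rule to_poly4_R_ideal)
    then show ?thesis by (simp add: h_def)
  qed
  have "bij_betw h (R_class ` degree_one_polys) UNIV"
    unfolding bij_betw_def
  proof
    \<comment> \<open>On the component, the class of \<open>from_poly4 (h A)\<close> is
      \<open>A\<close> again; the same map gives surjectivity below.\<close>
    show "inj_on h (R_class ` degree_one_polys)"
      by (rule inj_onI) (metis (no_types, lifting) from_poly4_to_poly4 h imageE)
    have "q = h (R_class (from_poly4 q))" for q by (simp add: h)
    then show "h ` R_class ` degree_one_polys = UNIV"
      using from_poly4_degree_one by blast
  qed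
  then have "h \<in> ring_iso (R_alg\<lparr>carrier := R_component \<one>\<^bsub>M16\<^esub>\<rparr>) poly4_ring"
    unfolding R_component_one poly4_ring_def
    by (intro ring_iso_memI) (auto simp: h to_poly4_mult to_poly4_one)
  moreover have "h (R_const k) = poly4_const k" for k
    by (simp add: R_const_def h poly4_const_def to_poly4_const)
  ultimately show ?thesis unfolding alg_isomorphic_def by blast
qed

theorem proposition3p1p2:
  shows "(R_component \<one>\<^bsub>M16\<^esub> :: 'k::{alg_closed_field, field_char_0} free_alg set set)
           = alg_generated R_alg R_const
               {R_var X1 \<otimes>\<^bsub>R_alg\<^esub> R_var X2, R_var X2 \<otimes>\<^bsub>R_alg\<^esub> R_var X1,
                R_var X3 \<otimes>\<^bsub>R_alg\<^esub> R_var X4, R_var X4 \<otimes>\<^bsub>R_alg\<^esub> R_var X3}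
         \<and> alg_isomorphic
             (R_alg\<lparr>carrier := (R_component \<one>\<^bsub>M16\<^esub> :: 'k free_alg set set)\<rparr>) R_const
             (poly4_ring :: 'k poly4 ring) poly4_const"
  using R_component_generated R_component_isomorphic by blast

end
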